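(* (1) $R^3(\partial K_2,\partial K_2)=3$. (2) $R^3(\partial K_2,\partial K_s)=s$ for $s\ge 3$. (3) $R^3(\partial K_t,\partial K_s)=t+s-3$ for $s,t\ge 3$. (4) $R^r(\partial K_t,\partial K_s)=\max\{s,t\}$ for $r\ge 4$ and $s,t\ge r$.
   Context: The 2-shadow $\partial_2(\mathcal{H})$ of a hypergraph $\mathcal{H}$ is the graph on $V(\mathcal{H})$ whose edges are the pairs $\{x,y\}$ contained in some hyperedge of $\mathcal{H}$. For a graph $G$, $\partial G$ is the set of $r$-uniform hypergraphs $\mathcal{H}$ whose 2-shadow contains $G$ as a subgraph (up to isomorphism). $K_n$ is the complete graph on $n$ vertices. For collections $\mathcal{F}_1,\mathcal{F}_2$ of $r$-uniform hypergraphs, $R^r(\mathcal{F}_1,\mathcal{F}_2)$ is the least $N$ such that every 2-coloring of the hyperedges of the complete $r$-uniform hypergraph on $N$ vertices contains a subhypergraph of the first color isomorphic to a member of $\mathcal{F}_1$ or one of the second color isomorphic to a member of $\mathcal{F}_2$. (Equivalently, for $\partial K_t$ with color $c$: a set of $t$ vertices every pair of which lies in some hyperedge of color $c$.) *)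

theory Defs
  imports "HOL-Library.Ramsey" "HOL-Library.Extended_Nat" "HOL-Library.FuncSet"
begin

text \<open>A hypergraph is a pair of a vertex set and a set of hyperedges; graphs are the
  2-uniform hypergraphs.\<close>

type_synonym 'a hypergraph = "'a set \<times> 'a set set"

abbreviation verts :: "'a hypergraph \<Rightarrow> 'a set" where
  "verts H \<equiv> fst H"

abbreviation hedges :: "'a hypergraph \<Rightarrow> 'a set set" where
  "hedges H \<equiv> snd H"

definition uniform :: "nat \<Rightarrow> 'a hypergraph \<Rightarrow> bool" where
  "uniform r H \<longleftrightarrow> finite (verts H) \<and> hedges H \<subseteq> nsets (verts H) r"

definition complete_hypergraph :: "nat \<Rightarrow> 'a set \<Rightarrow> 'a hypergraph" where
  "complete_hypergraph r V = (V, nsets V r)"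

definition K :: "nat \<Rightarrow> nat hypergraph" where
  "K n = complete_hypergraph 2 {..<n}"

definition subhypergraph :: "'a hypergraph \<Rightarrow> 'a hypergraph \<Rightarrow> bool" where
  "subhypergraph S H \<longleftrightarrow> verts S \<subseteq> verts H \<and> hedges S \<subseteq> hedges H"

definition isomorphic :: "'a hypergraph \<Rightarrow> 'b hypergraph \<Rightarrow> bool" where
  "isomorphic F H \<longleftrightarrow> (\<exists>f. bij_betw f (verts F) (verts H) \<and> hedges H = (`) f ` hedges F)"

definition contains_copy :: "'a hypergraph \<Rightarrow> 'b hypergraph \<Rightarrow> bool" where
  "contains_copy H F \<longleftrightarrow> (\<exists>S. subhypergraph S H \<and> isomorphic F S)"

definition two_shadow :: "'a hypergraph \<Rightarrow> 'a hypergraph" where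
  "two_shadow H =
     (verts H, {{x, y} | x y. x \<noteq> y \<and> (\<exists>e\<in>hedges H. {x, y} \<subseteq> e)})"

text \<open>The family \<open>\<partial>G\<close> depends on the uniformity \<open>r\<close>.  Its members are taken on vertices of
  type \<^typ>\<open>nat\<close>, which realises every finite hypergraph up to isomorphism.\<close>

definition shadow_family :: "nat \<Rightarrow> 'b hypergraph \<Rightarrow> nat hypergraph set" where
  "shadow_family r G = {H. uniform r H \<and> contains_copy (two_shadow H) G}"

definition colour_class ::
  "'a hypergraph \<Rightarrow> ('a set \<Rightarrow> nat) \<Rightarrow> nat \<Rightarrow> 'a hypergraph" where
  "colour_class H c i = (verts H, {e \<in> hedges H. c e = i})"

definition ramsey_arrow ::
  "nat \<Rightarrow> nat hypergraph set \<Rightarrow> nat hypergraph set \<Rightarrow> nat \<Rightarrow> bool" where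
  "ramsey_arrow r \<F>1 \<F>2 N \<longleftrightarrow>
     (let H = complete_hypergraph r {..<N} in
      \<forall>c \<in> hedges H \<rightarrow> {1, 2}.
        (\<exists>F\<in>\<F>1. contains_copy (colour_class H c 1) F) \<or>
        (\<exists>F\<in>\<F>2. contains_copy (colour_class H c 2) F))"

text \<open>Taken in \<^typ>\<open>enat\<close>, so that the value is \<open>\<infinity>\<close> if no \<open>N\<close> works; an equation with a finite
  value therefore asserts that the minimum is attained.\<close>

definition ramsey_number ::
  "nat \<Rightarrow> nat hypergraph set \<Rightarrow> nat hypergraph set \<Rightarrow> enat" where
  "ramsey_number r \<F>1 \<F>2 = Inf {enat N | N. ramsey_arrow r \<F>1 \<F>2 N}"

end

theory Submission
  imports Defs
begin

text \<open>
  Call a pair of vertices \<open>i\<close>-pure if no hyperedge of the other colour contains it.  A clique in the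
  shadow of colour 1 is a set without 2-pure pairs, and vice versa.  A 1-pure and a 2-pure pair
  cannot lie in a common hyperedge.  For \<open>r \<ge> 4\<close> any two pairs do, so one colour covers all pairs.
  For \<open>r = 3\<close> this says that the set \<open>A\<close> of vertices on 1-pure pairs is disjoint from the set
  \<open>B\<close> of vertices on 2-pure pairs.  Adding one vertex of \<open>A\<close> to the complement of \<open>A\<close> gives a clique of
  colour 2, adding one vertex of \<open>B\<close> to the complement of \<open>B\<close> gives one of colour 1, and
  \<open>|A| + |B| \<le> N\<close> makes one of them large enough.  The bound is attained by splitting the vertices
  into parts of sizes \<open>t - 2\<close> and \<open>s - 2\<close> and colouring each triple by its majority part.
\<close>

section \<open>Cliques in the shadow of one colour class\<close>

text \<open>The hyperedge covering a pair may leave \<open>T\<close>. This is a clique in the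
  2-shadow of the colour class, stated without copies and isomorphisms so that counting can take
  place inside \<open>V\<close>.\<close>

definition shadow_clique :: "nat \<Rightarrow> 'a set \<Rightarrow> ('a set \<Rightarrow> nat) \<Rightarrow> nat \<Rightarrow> 'a set \<Rightarrow> bool" where
  "shadow_clique r V c i T \<longleftrightarrow>
     T \<subseteq> V \<and> (\<forall>x\<in>T. \<forall>y\<in>T. x \<noteq> y \<longrightarrow> (\<exists>e\<in>nsets V r. c e = i \<and> x \<in> e \<and> y \<in> e))"

lemma shadow_clique_subset:
  "shadow_clique r V c i T \<Longrightarrow> S \<subseteq> T \<Longrightarrow> shadow_clique r V c i S"
  unfolding shadow_clique_def by blast

lemma shadow_clique_shrink:
  assumes "shadow_clique r V c i T" "k \<le> card T"
  shows "\<exists>S. card S = k \<and> shadow_clique r V c i S"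
  by (meson assms obtain_subset_with_card_n shadow_clique_subset)

lemma shadow_clique_card_le:
  "shadow_clique r V c i T \<Longrightarrow> finite V \<Longrightarrow> card T \<le> card V"
  by (simp add: shadow_clique_def card_mono)

text \<open>Used for lower bounds: a colour that never occurs has no clique on two or more
  vertices.\<close>

lemma shadow_clique_has_edge:
  assumes "shadow_clique r V c i T" "2 \<le> card T"
  obtains e where "e \<in> nsets V r" "c e = i"
proof -
  obtain x y where "x \<in> T" "y \<in> T" "x \<noteq> y"
    using assms(2) by (metis card_2_iff' obtain_subset_with_card_n subset_eq)
  then show ?thesis
    using assms(1) that unfolding shadow_clique_def by blast
qed

lemma shadow_clique_edge:
  "e \<in> nsets V r \<Longrightarrow> c e = i \<Longrightarrow> shadow_clique r V c i e"
  unfolding shadow_clique_def nsets_def by blast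

lemma nsets_superset:
  assumes "finite V" "X \<subseteq> V" "card X \<le> r" "r \<le> card V"
  obtains e where "e \<in> nsets V r" "X \<subseteq> e"
proof -
  obtain e where "X \<subseteq> e" "e \<subseteq> V" "card e = r"
    using exists_subset_between[OF assms(3,4,2,1)] by blast
  then show ?thesis
    using that[of e] assms(1) finite_subset unfolding nsets_def by blast
qed

section \<open>Reduction of the Ramsey number to cliques\<close>

text \<open>One injection places \<open>K t\<close> in the shadow of \<open>F\<close>, another
  places \<open>F\<close> in the colour class. Their composite \<open>h\<close> has the clique as
  its image, since hyperedges of \<open>F\<close> go to hyperedges of colour
  \<open>i\<close>.\<close>

lemma shadow_family_member_imp_clique:
  assumes F: "F \<in> shadow_family r (K t)"
    and copy: "contains_copy (colour_class (complete_hypergraph r V) c i) F"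
  shows "\<exists>T. card T = t \<and> shadow_clique r V c i T"
proof -
  obtain S where S: "verts S \<subseteq> V" "hedges S \<subseteq> {e \<in> nsets V r. c e = i}" "isomorphic F S"
    using copy unfolding contains_copy_def subhypergraph_def colour_class_def
      complete_hypergraph_def by auto
  obtain f where f: "bij_betw f (verts F) (verts S)" "hedges S = (`) f ` hedges F"
    using S(3) unfolding isomorphic_def by blast
  obtain S' where S': "verts S' \<subseteq> verts F" "hedges S' \<subseteq> hedges (two_shadow F)"
      "isomorphic (K t) S'"
    using F unfolding shadow_family_def contains_copy_def subhypergraph_def two_shadow_def by auto
  obtain g where g: "bij_betw g {..<t} (verts S')" "hedges S' = (`) g ` nsets {..<t} 2"
    using S'(3) unfolding isomorphic_def K_def complete_hypergraph_def by auto
  define h where "h = f \<circ> g"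
  have g_sub: "g ` {..<t} \<subseteq> verts F"
    using g(1) S'(1) by (simp add: bij_betw_def)
  have inj: "inj_on h {..<t}"
    unfolding h_def using f(1) g(1) g_sub
    by (meson bij_betw_def comp_inj_on inj_on_subset)
  have "\<exists>e\<in>nsets V r. c e = i \<and> h x \<in> e \<and> h y \<in> e" if "x < t" "y < t" "x \<noteq> y" for x y
  proof -
    have "{x, y} \<in> nsets {..<t} 2"
      using that by (simp add: nsets_def)
    then have "g ` {x, y} \<in> hedges (two_shadow F)"
      using g(2) S'(2) by blast
    then obtain e where e: "e \<in> hedges F" "{g x, g y} \<subseteq> e"
      unfolding two_shadow_def by (auto simp: doubleton_eq_iff)
    then have "f ` e \<in> nsets V r \<and> c (f ` e) = i"
      using f(2) S(2) by blast
    with e(2) show ?thesis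
      unfolding h_def by auto
  qed
  moreover have "h ` {..<t} \<subseteq> V"
    using g_sub f(1) S(1) unfolding h_def bij_betw_def by fastforce
  ultimately have "shadow_clique r V c i (h ` {..<t})"
    unfolding shadow_clique_def by auto
  then show ?thesis
    using card_image[OF inj] by auto
qed

text \<open>The whole colour class is taken as the member of the family. It must be a hypergraph on
  natural numbers, whence the type of \<open>V\<close>.\<close>

lemma shadow_clique_imp_family_member:
  fixes V :: "nat set"
  assumes fin: "finite V" and T: "card T = t" "shadow_clique r V c i T"
  shows "\<exists>F\<in>shadow_family r (K t). contains_copy (colour_class (complete_hypergraph r V) c i) F"
proof -
  define F where "F = colour_class (complete_hypergraph r V) c i"
  have F: "verts F = V" "hedges F = {e \<in> nsets V r. c e = i}"
    by (simp_all add: F_def colour_class_def complete_hypergraph_def)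
  have TV: "T \<subseteq> V"
    using T(2) unfolding shadow_clique_def by blast
  have "finite T"
    using TV fin finite_subset by blast
  then obtain g where g: "bij_betw g {..<t} T"
    using T(1) by (metis bij_betw_from_nat_into_finite)
  define S where "S = (T, (`) g ` nsets {..<t} 2)"
  have "isomorphic (K t) S"
    unfolding isomorphic_def K_def complete_hypergraph_def S_def using g by auto
  moreover have "subhypergraph S (two_shadow F)"
  proof -
    have "g ` p \<in> hedges (two_shadow F)" if "p \<in> nsets {..<t} 2" for p
    proof -
      obtain x y where p: "p = {x, y}" "x \<noteq> y" "x < t" "y < t"
        using \<open>p \<in> nsets {..<t} 2\<close> unfolding nsets_def card_2_iff by auto
      then have "g x \<in> T" "g y \<in> T" "g x \<noteq> g y"
        using g by (auto simp: bij_betw_def inj_on_def)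
      then obtain e where "e \<in> hedges F" "g x \<in> e" "g y \<in> e"
        using T(2) F(2) unfolding shadow_clique_def by blast
      then show ?thesis
        unfolding two_shadow_def p(1) using \<open>g x \<noteq> g y\<close> by auto
    qed
    then show ?thesis
      unfolding subhypergraph_def S_def using TV F(1) by (auto simp: two_shadow_def)
  qed
  moreover have "uniform r F"
    unfolding uniform_def F using fin by auto
  ultimately have "F \<in> shadow_family r (K t)"
    unfolding shadow_family_def contains_copy_def by blast
  moreover have "contains_copy F F"
    unfolding contains_copy_def subhypergraph_def isomorphic_def
    by (intro exI[of _ F] conjI exI[of _ id]) auto
  ultimately show ?thesis
    unfolding F_def by blast
qed

lemma ramsey_arrow_shadow_iff:
  "ramsey_arrow r (shadow_family r (K t)) (shadow_family r (K s)) N \<longleftrightarrow>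
     (\<forall>c \<in> nsets {..<N} r \<rightarrow> {1, 2}.
        (\<exists>T. card T = t \<and> shadow_clique r {..<N} c 1 T) \<or>
        (\<exists>T. card T = s \<and> shadow_clique r {..<N} c 2 T))"
proof -
  have "(\<exists>F\<in>shadow_family r (K k). contains_copy (colour_class (complete_hypergraph r {..<N}) c i) F)
      \<longleftrightarrow> (\<exists>T. card T = k \<and> shadow_clique r {..<N} c i T)" for k c i
    using shadow_family_member_imp_clique shadow_clique_imp_family_member[OF finite_lessThan]
    by blast
  then show ?thesis
    unfolding ramsey_arrow_def Let_def by (simp add: complete_hypergraph_def)
qed

text \<open>The infimum ranges over all \<open>N\<close> that work, so every smaller
  \<open>M\<close> is refuted separately instead of appealing to monotonicity.\<close>

lemma ramsey_number_eqI:
  assumes "ramsey_arrow r F G N" "\<And>M. M < N \<Longrightarrow> \<not> ramsey_arrow r F G M"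
  shows "ramsey_number r F G = enat N"
  unfolding ramsey_number_def
proof (rule antisym)
  show "Inf {enat M |M. ramsey_arrow r F G M} \<le> enat N"
    using assms(1) by (intro Inf_lower) blast
  show "enat N \<le> Inf {enat M |M. ramsey_arrow r F G M}"
    using assms(2) by (intro Inf_greatest) (force simp: not_less[symmetric])
qed

section \<open>An upper bound for small cliques, and colourings for the lower bounds\<close>

text \<open>A single hyperedge of colour 1 is already a clique on \<open>r\<close> vertices. Without
  one, everything has colour 2 and all vertices form a clique.\<close>

lemma ramsey_arrow_shadow_small:
  assumes "2 \<le> r" "r \<le> N" "t \<le> r" "s \<le> N"
  shows "ramsey_arrow r (shadow_family r (K t)) (shadow_family r (K s)) N"
  unfolding ramsey_arrow_shadow_iff
proof
  fix c assume c: "c \<in> nsets {..<N} r \<rightarrow> {1, 2::nat}"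
  show "(\<exists>T. card T = t \<and> shadow_clique r {..<N} c 1 T) \<or>
        (\<exists>T. card T = s \<and> shadow_clique r {..<N} c 2 T)"
  proof (cases "\<exists>e\<in>nsets {..<N} r. c e = 1")
    case True
    then obtain e where e: "e \<in> nsets {..<N} r" "c e = 1"
      by blast
    then have "t \<le> card e"
      using assms(3) by (simp add: nsets_def)
    then show ?thesis
      using shadow_clique_edge[of e "{..<N}" r c 1] e shadow_clique_shrink by blast
  next
    case False
    then have two: "c e = 2" if "e \<in> nsets {..<N} r" for e
      using c that by fastforce
    have "\<exists>e\<in>nsets {..<N} r. c e = 2 \<and> x \<in> e \<and> y \<in> e" if "x < N" "y < N" "x \<noteq> y" for x y
    proof -
      have "{x, y} \<subseteq> {..<N}" "card {x, y} \<le> r" "r \<le> card {..<N}"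
        using that assms by auto
      then obtain e where "e \<in> nsets {..<N} r" "{x, y} \<subseteq> e"
        using nsets_superset[OF finite_lessThan] by blast
      then show ?thesis
        using two by auto
    qed
    then have "shadow_clique r {..<N} c 2 {..<N}"
      unfolding shadow_clique_def by auto
    then show ?thesis
      using shadow_clique_shrink[of r "{..<N}" c 2 "{..<N}" s] assms(4) by auto
  qed
qed

text \<open>With fewer than \<open>r\<close> vertices there is nothing to colour. This gives the
  value 3 for two copies of \<open>K 2\<close>, where a constant colouring would exclude only
  \<open>M < 2\<close>.\<close>

lemma not_ramsey_arrow_shadow_few_vertices:
  assumes "M < r" "2 \<le> t" "2 \<le> s"
  shows "\<not> ramsey_arrow r (shadow_family r (K t)) (shadow_family r (K s)) M"
proof -
  have "nsets {..<M} r = {}"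
    using assms(1) by (simp add: nsets_eq_empty_iff)
  then show ?thesis
    unfolding ramsey_arrow_shadow_iff using assms shadow_clique_has_edge
    by (metis Pi_I empty_iff)
qed

lemma not_ramsey_arrow_shadow_constant:
  assumes "2 \<le> t" "2 \<le> s" "M < max s t"
  shows "\<not> ramsey_arrow r (shadow_family r (K t)) (shadow_family r (K s)) M"
proof -
  \<comment> \<open>The only colour used is one whose target clique has more than \<open>M\<close>
    vertices; the other colour has no hyperedge at all.\<close>
  define c :: "nat set \<Rightarrow> nat" where "c = (\<lambda>_. if M < s then 2 else 1)"
  have "c \<in> nsets {..<M} r \<rightarrow> {1, 2}"
    by (simp add: c_def)
  moreover have "card T \<noteq> t" if T: "shadow_clique r {..<M} c 1 T" for T
    using shadow_clique_card_le[OF T] shadow_clique_has_edge[OF T] assms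
    by (cases "M < s") (auto simp: c_def)
  moreover have "card T \<noteq> s" if T: "shadow_clique r {..<M} c 2 T" for T
    using shadow_clique_card_le[OF T] shadow_clique_has_edge[OF T] assms
    by (cases "M < s") (auto simp: c_def)
  ultimately show ?thesis
    unfolding ramsey_arrow_shadow_iff by blast
qed

lemma not_ramsey_arrow_shadow_majority:
  assumes "2 \<le> t" "2 \<le> s" "M < t + s - 3"
  shows "\<not> ramsey_arrow 3 (shadow_family 3 (K t)) (shadow_family 3 (K s)) M"
proof -
  \<comment> \<open>The size is chosen so that \<open>A\<close> with one foreign vertex has
    \<open>t - 1\<close> vertices, one too few.\<close>
  define A where "A = {..<t - 2}"
  define c :: "nat set \<Rightarrow> nat" where "c = (\<lambda>e. if 2 \<le> card (e \<inter> A) then 1 else 2)"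
  \<comment> \<open>Applied with \<open>X\<close> the part favoured by a colour and \<open>Y\<close>
    the other part, which a clique of that colour meets at most once.\<close>
  have bound: "card T \<le> card X + 1"
    if "T \<subseteq> X \<union> Y" "finite T" "finite X" "\<forall>x\<in>T \<inter> Y. \<forall>y\<in>T \<inter> Y. x = y" for T X Y :: "nat set"
  proof -
    have "card (T \<inter> Y) \<le> 1"
      using that(2,4) card_le_Suc0_iff_eq[of "T \<inter> Y"] by simp
    moreover have "card T \<le> card (X \<union> (T \<inter> Y))"
      using that by (intro card_mono) auto
    ultimately show ?thesis
      using card_Un_le[of X "T \<inter> Y"] by linarith
  qed
  have "c \<in> nsets {..<M} 3 \<rightarrow> {1, 2}"
    by (simp add: c_def)
  moreover have "card T \<noteq> t" if T: "shadow_clique 3 {..<M} c 1 T" for T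
  proof -
    have "x = y" if xy: "x \<in> T - A" "y \<in> T - A" for x y
    proof (rule ccontr)
      assume "x \<noteq> y"
      then obtain e where e: "e \<in> nsets {..<M} 3" "c e = 1" "x \<in> e" "y \<in> e"
        using T xy unfolding shadow_clique_def by blast
      then have "2 \<le> card (e \<inter> A)" "finite e" "card e = 3"
        by (auto simp: c_def nsets_def split: if_splits)
      \<comment> \<open>Two vertices outside \<open>A\<close> and at least two inside are too many
        for a triple.\<close>
      moreover have "card ({x, y} \<union> (e \<inter> A)) = 2 + card (e \<inter> A)"
        using xy \<open>x \<noteq> y\<close> \<open>finite e\<close> by (subst card_Un_disjoint) auto
      moreover have "card ({x, y} \<union> (e \<inter> A)) \<le> card e"
        using e \<open>finite e\<close> by (intro card_mono) auto
      ultimately show False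
        by linarith
    qed
    moreover have "finite T"
      using T finite_subset unfolding shadow_clique_def by blast
    ultimately have "card T \<le> card A + 1"
      using bound[of T A "- A"] finite_lessThan[of "t - 2"] unfolding A_def by blast
    then show ?thesis
      using assms by (auto simp: A_def)
  qed
  moreover have "card T \<noteq> s" if T: "shadow_clique 3 {..<M} c 2 T" for T
  proof -
    have "x = y" if xy: "x \<in> T \<inter> A" "y \<in> T \<inter> A" for x y
    proof (rule ccontr)
      assume "x \<noteq> y"
      then obtain e where e: "e \<in> nsets {..<M} 3" "c e = 2" "x \<in> e" "y \<in> e"
        using T xy unfolding shadow_clique_def by blast
      then have "card {x, y} \<le> card (e \<inter> A)"
        using xy by (intro card_mono) (auto simp: A_def)
      then show False
        using e(2) \<open>x \<noteq> y\<close> by (simp add: c_def)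
    qed
    moreover have "T \<subseteq> {..<M}"
      using T unfolding shadow_clique_def by blast
    ultimately have "card T \<le> card ({..<M} - A) + 1"
      using bound[of T "{..<M} - A" A] finite_subset[of T "{..<M}"] by auto
    \<comment> \<open>As \<open>M\<close> is at most \<open>t + s - 4\<close>, this part has at most
      \<open>s - 2\<close> vertices, so the clique has at most \<open>s - 1\<close>.\<close>
    also have "{..<M} - A = {t - 2..<M}"
      by (auto simp: A_def)
    finally show ?thesis
      using assms by auto
  qed
  ultimately show ?thesis
    unfolding ramsey_arrow_shadow_iff by blast
qed

section \<open>Upper bounds from pairs that avoid a colour\<close>

text \<open>For \<open>i = 1, 2\<close> this is a pair that is pure of the other colour \<open>3 - i\<close>.\<close>

definition avoids_colour :: "nat \<Rightarrow> 'a set \<Rightarrow> ('a set \<Rightarrow> nat) \<Rightarrow> nat \<Rightarrow> 'a \<Rightarrow> 'a \<Rightarrow> bool" where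
  "avoids_colour r V c i x y \<longleftrightarrow>
     x \<in> V \<and> y \<in> V \<and> x \<noteq> y \<and> (\<forall>e\<in>nsets V r. x \<in> e \<and> y \<in> e \<longrightarrow> c e \<noteq> i)"

lemma shadow_clique_iff_no_avoiding_pair:
  "shadow_clique r V c i T \<longleftrightarrow> T \<subseteq> V \<and> (\<forall>x\<in>T. \<forall>y\<in>T. \<not> avoids_colour r V c i x y)"
  unfolding shadow_clique_def avoids_colour_def by blast

text \<open>Otherwise some hyperedge would contain both pairs, and neither colour would be possible
  for it.\<close>

lemma avoiding_pairs_span_more_than_edge:
  assumes "finite V" "r \<le> card V" "c \<in> nsets V r \<rightarrow> {1, 2}"
    and "avoids_colour r V c 1 x y" "avoids_colour r V c 2 z w"
  shows "r < card {x, y, z, w}"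
proof (rule ccontr)
  assume "\<not> r < card {x, y, z, w}"
  moreover have "{x, y, z, w} \<subseteq> V"
    using assms(4,5) unfolding avoids_colour_def by blast
  ultimately obtain e where e: "e \<in> nsets V r" "{x, y, z, w} \<subseteq> e"
    using nsets_superset[of V "{x, y, z, w}" r] assms(1,2) by auto
  then have "c e \<noteq> 1" "c e \<noteq> 2"
    using assms(4,5) unfolding avoids_colour_def by auto
  then show False
    using assms(3) e(1) by blast
qed

text \<open>Two pairs span at most four vertices, hence at most \<open>r\<close>. So some colour is
  avoided by no pair, and the whole vertex set is a clique in it.\<close>

lemma ramsey_arrow_shadow_uniformity_ge_4:
  assumes "4 \<le> r" "r \<le> N" "t \<le> N" "s \<le> N"
  shows "ramsey_arrow r (shadow_family r (K t)) (shadow_family r (K s)) N"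
  unfolding ramsey_arrow_shadow_iff
proof
  fix c assume c: "c \<in> nsets {..<N} r \<rightarrow> {1, 2::nat}"
  have "\<not> (avoids_colour r {..<N} c 1 x y \<and> avoids_colour r {..<N} c 2 z w)" for x y z w
  proof
    assume "avoids_colour r {..<N} c 1 x y \<and> avoids_colour r {..<N} c 2 z w"
    then have "r < card {x, y, z, w}"
      using avoiding_pairs_span_more_than_edge[OF _ _ c] assms(2) by auto
    moreover have "card {x, y, z, w} \<le> 4"
      using card_length[of "[x, y, z, w]"] by simp
    ultimately show False
      using assms(1) by linarith
  qed
  then have "shadow_clique r {..<N} c 1 {..<N} \<or> shadow_clique r {..<N} c 2 {..<N}"
    unfolding shadow_clique_iff_no_avoiding_pair by blast
  then show "(\<exists>T. card T = t \<and> shadow_clique r {..<N} c 1 T) \<or>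
        (\<exists>T. card T = s \<and> shadow_clique r {..<N} c 2 T)"
    using shadow_clique_shrink assms(3,4) by (metis card_lessThan)
qed

text \<open>Both ends of an avoiding pair lie in \<open>B\<close>, so a set meeting \<open>B\<close>
  in one vertex contains no such pair. If \<open>B\<close> is empty there is no vertex to add back,
  hence the separate case.\<close>

lemma large_shadow_clique:
  fixes V :: "'a set" and c :: "'a set \<Rightarrow> nat" and r i :: nat
  assumes "finite V"
  defines "B \<equiv> {x. \<exists>y. avoids_colour r V c i x y}"
  obtains T where "shadow_clique r V c i T" "B = {} \<longrightarrow> card T = card V"
    "B \<noteq> {} \<longrightarrow> card T = card V - card B + 1"
proof (cases "B = {}")
  case True
  then have "shadow_clique r V c i V"
    unfolding shadow_clique_iff_no_avoiding_pair B_def by blast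
  then show ?thesis
    using that True by blast
next
  case False
  then obtain b where b: "b \<in> B"
    by blast
  have BV: "B \<subseteq> V"
    unfolding B_def avoids_colour_def by blast
  have sym: "avoids_colour r V c i x y \<Longrightarrow> avoids_colour r V c i y x" for x y
    unfolding avoids_colour_def by blast
  have irrefl: "\<not> avoids_colour r V c i x x" for x
    unfolding avoids_colour_def by blast
  have "shadow_clique r V c i (insert b (V - B))"
    unfolding shadow_clique_iff_no_avoiding_pair
  proof (intro conjI ballI notI)
    show "insert b (V - B) \<subseteq> V"
      using b BV by blast
    fix x y assume "x \<in> insert b (V - B)" "y \<in> insert b (V - B)" "avoids_colour r V c i x y"
    moreover from this(3) have "x \<in> B" "y \<in> B"
      using sym unfolding B_def by blast+
    \<comment> \<open>The only element of \<open>B\<close> in the set is \<open>b\<close>, so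
      \<open>x\<close> and \<open>y\<close> would coincide.\<close>
    ultimately show False
      using irrefl by blast
  qed
  moreover have "card (insert b (V - B)) = card V - card B + 1"
    using b BV assms(1) finite_subset[OF BV] by (simp add: card_Diff_subset)
  ultimately show ?thesis
    using that False by blast
qed

lemma ramsey_arrow_shadow_3:
  assumes "3 \<le> t" "3 \<le> s"
  shows "ramsey_arrow 3 (shadow_family 3 (K t)) (shadow_family 3 (K s)) (t + s - 3)"
  unfolding ramsey_arrow_shadow_iff
proof
  define N where "N = t + s - 3"
  fix c assume "c \<in> nsets {..<t + s - 3} 3 \<rightarrow> {1, 2::nat}"
  then have c: "c \<in> nsets {..<N} 3 \<rightarrow> {1, 2}"
    by (simp add: N_def)
  \<comment> \<open>In the notation of the overview, \<open>B 2\<close> is the set \<open>A\<close>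
    of vertices on 1-pure pairs and \<open>B 1\<close> is the set \<open>B\<close>.\<close>
  define B where "B i = {x. \<exists>y. avoids_colour 3 {..<N} c i x y}" for i
  have sub: "B i \<subseteq> {..<N}" for i
    unfolding B_def avoids_colour_def by blast
  \<comment> \<open>Pairs sharing a vertex span at most three vertices, which fit into one
    triple.\<close>
  have "B 1 \<inter> B 2 = {}"
  proof (rule ccontr)
    assume "B 1 \<inter> B 2 \<noteq> {}"
    then obtain x y z where "avoids_colour 3 {..<N} c 1 x y" "avoids_colour 3 {..<N} c 2 x z"
      unfolding B_def by blast
    then have "3 < card {x, y, x, z}"
      using avoiding_pairs_span_more_than_edge[OF _ _ c] assms by (auto simp: N_def)
    moreover have "{x, y, x, z} = {x, y, z}"
      by blast
    moreover have "card {x, y, z} \<le> 3"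
      using card_length[of "[x, y, z]"] by simp
    ultimately show False
      by simp
  qed
  then have "card (B 1) + card (B 2) = card (B 1 \<union> B 2)"
    using sub finite_subset by (metis card_Un_disjoint finite_lessThan)
  also have "\<dots> \<le> N"
    using card_mono[of "{..<N}" "B 1 \<union> B 2"] sub by simp
  finally have le: "card (B 1) + card (B 2) \<le> N" .
  obtain T1 where T1: "shadow_clique 3 {..<N} c 1 T1" "B 1 = {} \<longrightarrow> card T1 = N"
      "B 1 \<noteq> {} \<longrightarrow> card T1 = N - card (B 1) + 1"
    using large_shadow_clique[of "{..<N}" 3 c 1] unfolding B_def by auto
  obtain T2 where T2: "shadow_clique 3 {..<N} c 2 T2" "B 2 = {} \<longrightarrow> card T2 = N"
      "B 2 \<noteq> {} \<longrightarrow> card T2 = N - card (B 2) + 1"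
    using large_shadow_clique[of "{..<N}" 3 c 2] unfolding B_def by auto
  \<comment> \<open>If both sets are nonempty and both cliques too small, adding the sizes gives
    \<open>2 * N - (card (B 1) + card (B 2))\<close> at most \<open>t + s - 4\<close>, contradicting
    \<open>le\<close>. If one is empty, the clique has \<open>N\<close> vertices, enough because
    \<open>t\<close> and \<open>s\<close> are at least 3.\<close>
  have "t \<le> card T1 \<or> s \<le> card T2"
    using T1(2,3) T2(2,3) le assms
    by (cases "B 1 = {}"; cases "B 2 = {}") (auto simp: N_def)
  then have "(\<exists>T. card T = t \<and> shadow_clique 3 {..<N} c 1 T) \<or>
        (\<exists>T. card T = s \<and> shadow_clique 3 {..<N} c 2 T)"
    using shadow_clique_shrink T1(1) T2(1) by blast
  then show "(\<exists>T. card T = t \<and> shadow_clique 3 {..<t + s - 3} c 1 T) \<or>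
        (\<exists>T. card T = s \<and> shadow_clique 3 {..<t + s - 3} c 2 T)"
    by (simp add: N_def)
qed

section \<open>The four values\<close>

theorem theorem1p16:
  shows "ramsey_number 3 (shadow_family 3 (K 2)) (shadow_family 3 (K 2)) = enat 3 \<and>
    (\<forall>s::nat. s \<ge> 3 \<longrightarrow>
       ramsey_number 3 (shadow_family 3 (K 2)) (shadow_family 3 (K s)) = enat s) \<and>
    (\<forall>t s::nat. t \<ge> 3 \<and> s \<ge> 3 \<longrightarrow>
       ramsey_number 3 (shadow_family 3 (K t)) (shadow_family 3 (K s)) = enat (t + s - 3)) \<and>
    (\<forall>r t s::nat. r \<ge> 4 \<and> s \<ge> r \<and> t \<ge> r \<longrightarrow>
       ramsey_number r (shadow_family r (K t)) (shadow_family r (K s)) = enat (max s t))"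
proof (intro conjI allI impI; rule ramsey_number_eqI)
  show "ramsey_arrow 3 (shadow_family 3 (K 2)) (shadow_family 3 (K 2)) 3"
    by (rule ramsey_arrow_shadow_small) auto
  show "\<not> ramsey_arrow 3 (shadow_family 3 (K 2)) (shadow_family 3 (K 2)) M" if "M < 3" for M
    using that by (intro not_ramsey_arrow_shadow_few_vertices) auto
next
  fix s :: nat assume "3 \<le> s"
  then show "ramsey_arrow 3 (shadow_family 3 (K 2)) (shadow_family 3 (K s)) s"
    by (intro ramsey_arrow_shadow_small) auto
  show "\<not> ramsey_arrow 3 (shadow_family 3 (K 2)) (shadow_family 3 (K s)) M" if "M < s" for M
    using that \<open>3 \<le> s\<close> by (intro not_ramsey_arrow_shadow_constant) auto
next
  fix t s :: nat assume "3 \<le> t \<and> 3 \<le> s"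
  then show "ramsey_arrow 3 (shadow_family 3 (K t)) (shadow_family 3 (K s)) (t + s - 3)"
    by (intro ramsey_arrow_shadow_3) auto
  show "\<not> ramsey_arrow 3 (shadow_family 3 (K t)) (shadow_family 3 (K s)) M"
    if "M < t + s - 3" for M
    using that \<open>3 \<le> t \<and> 3 \<le> s\<close> by (intro not_ramsey_arrow_shadow_majority) auto
next
  fix r t s :: nat assume "4 \<le> r \<and> r \<le> s \<and> r \<le> t"
  then show "ramsey_arrow r (shadow_family r (K t)) (shadow_family r (K s)) (max s t)"
    by (intro ramsey_arrow_shadow_uniformity_ge_4) auto
  show "\<not> ramsey_arrow r (shadow_family r (K t)) (shadow_family r (K s)) M"
    if "M < max s t" for M
    using that \<open>4 \<le> r \<and> r \<le> s \<and> r \<le> t\<close> by (intro not_ramsey_arrow_shadow_constant) auto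
qed

end
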